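(* Let $m,n\in\mathbb{N}$ with $m<n$, let $0<s\le n$ be fixed, let $M\in\mathbb{R}^{m\times n}$ have full rank, let $p\in\mathbb{R}^m$, and set $A_s=\{x\in\mathbb{R}^n : \|x\|_0\le s\}$ and $B=\{x\in\mathbb{R}^n : Mx=p\}$. Let $M^\dagger=M^\top(MM^\top)^{-1}$ and suppose that, with $\delta_{2s}\in[0,\frac12)$, $$(1-\delta_{2s})\|x\|_2^2\le\|M^\dagger Mx\|_2^2\qquad\text{for all }x\in A_{2s}.$$ Then $B\cap A_s$ is a singleton, and for any initial value $x^0\in\mathbb{R}^n$ the sequence $(x^k)_{k\in\mathbb{N}}$ generated by alternating projections, $x^{k+1}\in P_{A_s}P_Bx^k$, converges to $B\cap A_s$, with $d_B(x^k)\to0$ as $k\to\infty$ at a linear rate with constant bounded by $\sqrt{\frac{\delta_{2s}}{1-\delta_{2s}}}$.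
   Context: $\|x\|_0$ is the number of nonzero entries of $x$; $A_{2s}=\{x\in\mathbb{R}^n:\|x\|_0\le 2s\}$; $\mathbb{N}$ denotes the nonnegative integers. $d_\Omega(x)=\inf_{y\in\Omega}\|x-y\|_2$, and for closed nonempty $\Omega\subset\mathbb{R}^n$ the (possibly set-valued) projector is $P_\Omega(x)=\operatorname{argmin}_{y\in\Omega}\|x-y\|_2$.
   Formalization: The formal theorem additionally assumes that A_s ∩ B is nonempty; without this the claim fails, e.g. M=[I_4 | −1], p=(1,2,3,4), s=1, δ=2/5, where B contains no 1-sparse vector. *)

theory Defs
  imports "HOL-Analysis.Analysis"
begin

definition l0_norm :: "real ^ 'n \<Rightarrow> nat" where
  "l0_norm x = card {i. x $ i \<noteq> 0}"

definition sparse_set :: "nat \<Rightarrow> (real ^ 'n) set" where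
  "sparse_set s = {x. l0_norm x \<le> s}"

definition affine_solutions :: "real ^ 'n ^ 'm \<Rightarrow> real ^ 'm \<Rightarrow> (real ^ 'n) set" where
  "affine_solutions M p = {x. M *v x = p}"

text \<open>Meaningful only when the rows of \<open>M\<close> are linearly independent, so that
  \<open>M ** transpose M\<close> is invertible.\<close>

definition right_pinv :: "real ^ 'n ^ 'm \<Rightarrow> real ^ 'm ^ 'n" where
  "right_pinv M = transpose M ** matrix_inv (M ** transpose M)"

text \<open>The projector is set-valued: for nonconvex \<open>\<Omega>\<close>, such as \<open>sparse_set s\<close>,
  nearest points need not be unique.\<close>

definition projector :: "'a::real_normed_vector set \<Rightarrow> 'a \<Rightarrow> 'a set" where
  "projector \<Omega> x = {y. is_arg_min (\<lambda>z. norm (x - z)) (\<lambda>z. z \<in> \<Omega>) y}"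

text \<open>\<open>is_AP_sequence A B x\<close> is the inclusion \<open>x\<^sup>k\<^sup>+\<^sup>1 \<in> P\<^sub>A P\<^sub>B x\<^sup>k\<close>: the projection
  onto \<open>B\<close> comes first, and every selection from the projectors is allowed.
  The initial value \<open>x 0\<close> is unconstrained.\<close>

definition is_AP_sequence ::
  "'a::real_normed_vector set \<Rightarrow> 'a set \<Rightarrow> (nat \<Rightarrow> 'a) \<Rightarrow> bool" where
  "is_AP_sequence A B x \<longleftrightarrow>
     (\<forall>k. x (Suc k) \<in> (\<Union>y\<in>projector B (x k). projector A y))"

end

theory Submission
  imports Defs
begin

text \<open>The matrix \<open>Q = M\<^sup>\<dagger> M\<close> is the orthogonal projection onto the orthogonal complement of the kernel
  of \<open>M\<close>, so for \<open>x\<^sub>* \<in> A \<inter> B\<close> the distance from \<open>x\<close> to \<open>B\<close> is \<open>\<parallel>Q (x - x\<^sub>*)\<parallel>\<close>. Write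
  \<open>u = x - x\<^sub>*\<close> and \<open>v = x\<^sup>+ - x\<^sub>*\<close> for consecutive iterates, and \<open>w = u - Q u\<close>, the error of
  the projection of \<open>x\<close> onto \<open>B\<close>. As \<open>x\<^sub>*\<close> competes with \<open>x\<^sup>+\<close> in the projection onto \<open>A\<close>,
  \<open>\<parallel>v - w\<parallel> \<le> \<parallel>w\<parallel>\<close>, and the component of \<open>v - w\<close> in the range of \<open>Q\<close> is \<open>Q v\<close>; hence
  \<open>\<parallel>Q v\<parallel> \<le> \<parallel>w\<parallel>\<close>. Since \<open>u\<close> is \<open>2s\<close>-sparse, the hypothesis turns
  \<open>\<parallel>w\<parallel>\<^sup>2 = \<parallel>u\<parallel>\<^sup>2 - \<parallel>Q u\<parallel>\<^sup>2\<close> into \<open>\<parallel>w\<parallel>\<^sup>2 \<le> \<delta> / (1 - \<delta>) \<parallel>Q u\<parallel>\<^sup>2\<close>.\<close>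

lemma sparse_set_diff:
  assumes "x \<in> sparse_set s" and "y \<in> sparse_set t"
  shows "x - y \<in> sparse_set (s + t)"
proof -
  have "card {i. (x - y) $ i \<noteq> 0} \<le> card ({i. x $ i \<noteq> 0} \<union> {i. y $ i \<noteq> 0})"
    by (rule card_mono) auto
  also have "\<dots> \<le> card {i. x $ i \<noteq> 0} + card {i. y $ i \<noteq> 0}"
    by (rule card_Un_le)
  finally show ?thesis
    using assms by (simp add: sparse_set_def l0_norm_def)
qed

lemma inner_transpose_mult:
  fixes M :: "real ^ 'n ^ 'm"
  shows "(transpose M *v y) \<bullet> z = y \<bullet> (M *v z)"
  by (simp add: transpose_matrix_vector dot_lmul_matrix)

text \<open>Gram matrix argument: a kernel vector \<open>x\<close> satisfies
  \<open>norm (transpose M *v x) = 0\<close>, and full row rank makes \<open>transpose M\<close>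
  injective.\<close>

lemma invertible_mult_transpose:
  fixes M :: "real ^ 'n ^ 'm"
  assumes "rank M = CARD('m)"
  shows "invertible (M ** transpose M)"
proof -
  have inj: "inj ((*v) (transpose M))"
    using assms by (simp add: full_rank_injective[symmetric] rank_transpose del: transpose_matrix_vector)
  have "x = 0" if "(M ** transpose M) *v x = 0" for x
  proof -
    have "(transpose M *v x) \<bullet> (transpose M *v x) = x \<bullet> ((M ** transpose M) *v x)"
      by (simp only: inner_transpose_mult matrix_vector_mul_assoc)
    then have "transpose M *v x = transpose M *v 0"
      using that by simp
    then show "x = 0"
      using inj by (simp only: inj_eq)
  qed
  then show ?thesis
    by (simp add: invertible_left_inverse matrix_left_invertible_ker)
qed

lemma mult_right_pinv:
  fixes M :: "real ^ 'n ^ 'm"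
  assumes "rank M = CARD('m)"
  shows "M ** right_pinv M = mat 1"
proof -
  have "(M ** transpose M) ** matrix_inv (M ** transpose M) = mat 1"
    \<comment> \<open>\<open>matrix_inv\<close> is a choice among two-sided inverses; invertibility
      supplies the witness.\<close>
    using someI_ex[OF invertible_mult_transpose[OF assms, unfolded invertible_def]]
    by (simp add: matrix_inv_def)
  then show ?thesis
    by (simp add: right_pinv_def matrix_mul_assoc)
qed

lemma mult_right_pinv_mult:
  fixes M :: "real ^ 'n ^ 'm"
  assumes "rank M = CARD('m)"
  shows "M *v ((right_pinv M ** M) *v x) = M *v x"
  by (simp add: matrix_vector_mul_assoc matrix_mul_assoc mult_right_pinv[OF assms])

text \<open>The leftmost factor of \<open>right_pinv M\<close> is \<open>transpose M\<close>, whose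
  range is orthogonal to the kernel of \<open>M\<close>.\<close>

lemma right_pinv_inner_ker:
  fixes M :: "real ^ 'n ^ 'm"
  assumes "M *v z = 0"
  shows "((right_pinv M ** M) *v x) \<bullet> z = 0"
proof -
  have "(right_pinv M ** M) *v x =
      transpose M *v (matrix_inv (M ** transpose M) *v (M *v x))"
    by (simp add: right_pinv_def matrix_vector_mul_assoc matrix_mul_assoc)
  then show ?thesis
    using assms by (simp only: inner_transpose_mult inner_zero_right)
qed

lemma norm_right_pinv_add_ker:
  fixes M :: "real ^ 'n ^ 'm"
  assumes "M *v z = 0"
  shows "(norm ((right_pinv M ** M) *v x + z))\<^sup>2 =
    (norm ((right_pinv M ** M) *v x))\<^sup>2 + (norm z)\<^sup>2"
  by (rule norm_add_Pythagorean)
    (simp add: orthogonal_def right_pinv_inner_ker[OF assms])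

text \<open>For \<open>z\<close> in the affine set, \<open>x - z\<close> is \<open>q\<close> plus a
  kernel vector of \<open>M\<close>, and \<open>q\<close> is orthogonal to the kernel. By Pythagoras
  \<open>norm (x - z)\<close> is least exactly when that kernel vector vanishes, that is, at
  \<open>z = x - q\<close>.\<close>

lemma
  fixes M :: "real ^ 'n ^ 'm"
  assumes rank: "rank M = CARD('m)" and b: "b \<in> affine_solutions M p"
  shows projector_affine_solutions:
      "projector (affine_solutions M p) x = {x - (right_pinv M ** M) *v (x - b)}"
    and infdist_affine_solutions:
      "infdist x (affine_solutions M p) = norm ((right_pinv M ** M) *v (x - b))"
proof -
  define q where "q = (right_pinv M ** M) *v (x - b)"
  let ?B = "affine_solutions M p"
  have Mq: "M *v q = M *v x - p"
    using b unfolding q_def mult_right_pinv_mult[OF rank]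
    by (simp add: affine_solutions_def matrix_vector_mult_diff_distrib)
  have in_B: "x - q \<in> ?B"
    using Mq by (simp add: affine_solutions_def matrix_vector_mult_diff_distrib)
  have pyth: "(norm (x - z))\<^sup>2 = (norm q)\<^sup>2 + (norm (x - z - q))\<^sup>2" if "z \<in> ?B" for z
  proof -
    have "M *v (x - z - q) = 0"
      using Mq that by (simp add: affine_solutions_def matrix_vector_mult_diff_distrib)
    from norm_right_pinv_add_ker[OF this, of "x - b"] show ?thesis
      by (simp flip: q_def)
  qed
  have le: "norm q \<le> norm (x - z)" if "z \<in> ?B" for z
    by (rule power2_le_imp_le) (simp_all add: pyth[OF that])
  have uniq: "z = x - q" if "z \<in> ?B" "norm (x - z) \<le> norm q" for z
  proof -
    have "norm (x - z) = norm q"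
      using le[OF that(1)] that(2) by simp
    then have "x - z - q = 0"
      using pyth[OF that(1)] by simp
    then show ?thesis
      by (simp add: algebra_simps)
  qed
  have mem_proj: "z \<in> projector ?B x \<longleftrightarrow> z \<in> ?B \<and> norm (x - z) \<le> norm q" for z
    using in_B le by (auto simp: projector_def is_arg_min_linorder intro: order_trans)
  have "x - q \<in> projector ?B x"
    unfolding mem_proj using in_B by simp
  moreover have "z = x - q" if "z \<in> projector ?B x" for z
    using that unfolding mem_proj by (blast intro: uniq)
  ultimately show "projector ?B x = {x - q}"
    by blast
  show "infdist x ?B = norm q"
  proof (rule antisym)
    show "infdist x ?B \<le> norm q"
      using infdist_le[OF in_B, of x] by (simp add: dist_norm)
    show "norm q \<le> infdist x ?B"
      unfolding infdist_def using in_B le by (auto simp: dist_norm intro: cINF_greatest)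
  qed
qed

text \<open>\<open>A\<close> is an arbitrary set here: it enters through the competitor
  \<open>xs\<close>, and sparsity is condensed into the inequality for the single vector
  \<open>x - xs\<close>.\<close>

lemma AP_step_infdist_le:
  fixes M :: "real ^ 'n ^ 'm"
  assumes rank: "rank M = CARD('m)" and \<delta>: "\<delta> < 1"
    and xs: "xs \<in> affine_solutions M p" "xs \<in> A"
    and x: "(1 - \<delta>) * (norm (x - xs))\<^sup>2 \<le> (norm ((right_pinv M ** M) *v (x - xs)))\<^sup>2"
    and y: "y \<in> projector (affine_solutions M p) x" and x': "x' \<in> projector A y"
  shows "infdist x' (affine_solutions M p) \<le>
    sqrt (\<delta> / (1 - \<delta>)) * infdist x (affine_solutions M p)"
proof -
  let ?B = "affine_solutions M p"
  let ?Q = "(*v) (right_pinv M ** M)"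
  define u where "u = x - xs"
  define v where "v = x' - xs"
  define w where "w = u - ?Q u"
  have y_eq: "y = xs + w"
    using y projector_affine_solutions[OF rank xs(1), of x] by (simp add: w_def u_def)
  have dist_x: "infdist x ?B = norm (?Q u)"
    unfolding u_def by (rule infdist_affine_solutions[OF rank xs(1)])
  have dist_x': "infdist x' ?B = norm (?Q v)"
    unfolding v_def by (rule infdist_affine_solutions[OF rank xs(1)])
  have Mw: "M *v w = 0"
    unfolding w_def matrix_vector_mult_diff_distrib mult_right_pinv_mult[OF rank] by simp
  \<comment> \<open>Both \<open>v - ?Q v\<close> and \<open>w\<close> lie in the kernel of
    \<open>M\<close>, so \<open>v - w\<close> splits orthogonally into \<open>?Q v\<close> and a
    kernel vector.\<close>
  have "M *v (v - ?Q v - w) = 0"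
    using Mw unfolding matrix_vector_mult_diff_distrib mult_right_pinv_mult[OF rank] by simp
  from norm_right_pinv_add_ker[OF this, of v]
  have "(norm (v - w))\<^sup>2 = (norm (?Q v))\<^sup>2 + (norm (v - ?Q v - w))\<^sup>2"
    by simp
  then have "(norm (?Q v))\<^sup>2 \<le> (norm (v - w))\<^sup>2"
    by simp
  then have "norm (?Q v) \<le> norm (v - w)"
    by (rule power2_le_imp_le) simp
  also have "v - w = - (y - x')"
    by (simp add: v_def y_eq)
  also have "norm (- (y - x')) \<le> norm (y - xs)"
    using x' xs(2) unfolding norm_minus_cancel by (simp add: projector_def is_arg_min_linorder)
  also have "y - xs = w"
    by (simp add: y_eq)
  finally have Qv: "norm (?Q v) \<le> norm w" .
  have pyth: "(norm u)\<^sup>2 = (norm (?Q u))\<^sup>2 + (norm w)\<^sup>2"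
    using norm_right_pinv_add_ker[OF Mw, of u] by (simp add: w_def)
  have "(1 - \<delta>) * (norm w)\<^sup>2 \<le> \<delta> * (norm (?Q u))\<^sup>2"
    using x unfolding u_def[symmetric] pyth by (simp add: algebra_simps)
  then have "(norm w)\<^sup>2 \<le> \<delta> / (1 - \<delta>) * (norm (?Q u))\<^sup>2"
    using \<delta> by (simp add: pos_le_divide_eq mult.commute)
  then have "norm w \<le> sqrt (\<delta> / (1 - \<delta>) * (norm (?Q u))\<^sup>2)"
    by (rule real_le_rsqrt)
  also have "\<dots> = sqrt (\<delta> / (1 - \<delta>)) * norm (?Q u)"
    by (simp only: real_sqrt_mult real_sqrt_abs abs_norm_cancel)
  finally show ?thesis
    using Qv unfolding dist_x dist_x' by linarith
qed

text \<open>Geometric decay from index \<open>N\<close> on. The offset allows for a starting point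
  outside \<open>A\<close>, where the contraction estimate may fail.\<close>

lemma tendsto_zero_of_contraction:
  fixes f :: "nat \<Rightarrow> real"
  assumes "0 \<le> \<kappa>" "\<kappa> < 1" "\<And>k. 0 \<le> f k" "\<And>k. N \<le> k \<Longrightarrow> f (Suc k) \<le> \<kappa> * f k"
  shows "f \<longlonglongrightarrow> 0"
proof -
  have bound: "f (k + N) \<le> f N * \<kappa> ^ k" for k
  proof (induction k)
    case (Suc k)
    have "f (Suc k + N) \<le> \<kappa> * f (k + N)"
      using assms(4)[of "k + N"] by simp
    also have "\<dots> \<le> \<kappa> * (f N * \<kappa> ^ k)"
      using Suc assms(1) by (rule mult_left_mono)
    finally show ?case
      by (simp add: mult_ac)
  qed simp
  have "(\<lambda>k. f N * \<kappa> ^ k) \<longlonglongrightarrow> 0"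
    using tendsto_mult_right_zero[OF LIMSEQ_realpow_zero[OF assms(1,2)]] .
  then have "(\<lambda>k. f (k + N)) \<longlonglongrightarrow> 0"
    by (rule tendsto_sandwich[rotated 3]) (use bound assms(3) in auto)
  then show ?thesis
    by (rule LIMSEQ_offset)
qed

theorem theorem3p15:
  fixes M :: "real ^ 'n ^ 'm" and p :: "real ^ 'm" and s :: nat and \<delta> :: real
    and A B :: "(real ^ 'n) set"
  assumes "CARD('m) < CARD('n)"
    and "0 < s" and "s \<le> CARD('n)"
    and "rank M = CARD('m)"
    and "A = sparse_set s"
    and "B = affine_solutions M p"
    and "A \<inter> B \<noteq> {}"
    and "0 \<le> \<delta>" and "\<delta> < 1 / 2"
    and "\<forall>x \<in> sparse_set (2 * s).
           (1 - \<delta>) * (norm x)\<^sup>2 \<le> (norm ((right_pinv M ** M) *v x))\<^sup>2"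
  shows "\<exists>xs. B \<inter> A = {xs} \<and>
           (\<forall>x0 x. x 0 = x0 \<and> is_AP_sequence A B x \<longrightarrow>
              x \<longlonglongrightarrow> xs \<and>
              (\<lambda>k. infdist (x k) B) \<longlonglongrightarrow> 0 \<and>
              (\<exists>\<kappa>. 0 \<le> \<kappa> \<and> \<kappa> < 1 \<and> \<kappa> \<le> sqrt (\<delta> / (1 - \<delta>)) \<and>
                   (\<forall>k\<ge>1. infdist (x (Suc k)) B \<le> \<kappa> * infdist (x k) B)))"
proof -
  note rank = assms(4) and \<delta> = assms(8,9)
  let ?Q = "(*v) (right_pinv M ** M)"
  define \<kappa> where "\<kappa> = sqrt (\<delta> / (1 - \<delta>))"
  \<comment> \<open>The bound \<open>\<delta> < 1 / 2\<close> is exactly what puts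
    \<open>\<delta> / (1 - \<delta>)\<close> below 1.\<close>
  have \<kappa>: "0 \<le> \<kappa>" "\<kappa> < 1"
    using \<delta> by (simp_all add: \<kappa>_def)
  have sparse: "(1 - \<delta>) * (norm (a - b))\<^sup>2 \<le> (norm (?Q (a - b)))\<^sup>2"
    if "a \<in> A" "b \<in> A" for a b
    using sparse_set_diff[of a s b s] that assms(5,10) by (simp add: mult_2)
  obtain xs where xs: "xs \<in> A" "xs \<in> affine_solutions M p"
    using assms(6,7) by blast
  \<comment> \<open>On \<open>A\<close> the distance to \<open>B\<close> controls the distance to
    \<open>xs\<close>. This serves twice: for \<open>a\<close> in \<open>B\<close> the right-hand
    side is 0, which gives uniqueness, and along the iteration it turns decay of the distance to
    \<open>B\<close> into convergence to \<open>xs\<close>.\<close>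
  have err: "(norm (a - xs))\<^sup>2 \<le> (infdist a B)\<^sup>2 / (1 - \<delta>)" if "a \<in> A" for a
    using sparse[OF that xs(1)] \<delta>
    unfolding assms(6) infdist_affine_solutions[OF rank xs(2)] by (simp add: field_simps)
  have "a = xs" if "a \<in> A" "a \<in> B" for a
    using err[OF that(1)] that(2) by simp
  then have single: "B \<inter> A = {xs}"
    using xs assms(6) by blast
  have "x \<longlonglongrightarrow> xs \<and> (\<lambda>k. infdist (x k) B) \<longlonglongrightarrow> 0 \<and>
      (\<forall>k\<ge>1. infdist (x (Suc k)) B \<le> \<kappa> * infdist (x k) B)" if AP: "is_AP_sequence A B x" for x
  proof -
    have step: "\<exists>y\<in>projector B (x k). x (Suc k) \<in> projector A y" for k
      using AP by (auto simp: is_AP_sequence_def)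
    \<comment> \<open>Every iterate after the first is a projection onto \<open>A\<close>;
      \<open>x 0\<close> is arbitrary, so index 0 is excluded here and in the rate.\<close>
    have in_A: "x k \<in> A" if "k \<ge> 1" for k
      using step[of "k - 1"] that by (auto simp: projector_def is_arg_min_def)
    have rate: "infdist (x (Suc k)) B \<le> \<kappa> * infdist (x k) B" if "1 \<le> k" for k
      using step[of k] AP_step_infdist_le[OF rank _ xs(2,1) sparse[OF in_A[OF that] xs(1)]] \<delta>
      unfolding assms(6) \<kappa>_def by auto
    then have lim: "(\<lambda>k. infdist (x k) B) \<longlonglongrightarrow> 0"
      by (rule tendsto_zero_of_contraction[OF \<kappa> infdist_nonneg])
    have "(\<lambda>k. (infdist (x k) B)\<^sup>2 / (1 - \<delta>)) \<longlonglongrightarrow> 0\<^sup>2 / (1 - \<delta>)"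
      using \<delta> by (intro tendsto_intros lim) auto
    then have "(\<lambda>k. (infdist (x k) B)\<^sup>2 / (1 - \<delta>)) \<longlonglongrightarrow> 0"
      by simp
    \<comment> \<open>Squeeze between 0 and the bound \<open>err\<close>, which applies from index 1
      on.\<close>
    then have "(\<lambda>k. (norm (x k - xs))\<^sup>2) \<longlonglongrightarrow> 0"
      by (rule tendsto_sandwich[rotated 3, where f = "\<lambda>_. 0"])
        (auto intro: eventually_sequentiallyI[of 1] err in_A)
    then have "x \<longlonglongrightarrow> xs"
      by (simp add: tendsto_norm_zero_iff LIM_zero_iff)
    with lim rate show ?thesis
      by blast
  qed
  with single \<kappa> show ?thesis
    unfolding \<kappa>_def by blast
qed

end
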